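(* Let $n,m$ be positive integers such that $1<m<n$. Let $k=n-m$. Then, for any $k$-critical-bipartite graph $G=(U,V;E)$ with $|U|=n$ and $|V|=m$, we have $\kappa(G)\geq\min\{\delta(G),k\}$.
   Context: All graphs are finite, simple and undirected. $G=(U,V;E)$ denotes a bipartite graph with color classes $U,V$ and edge set $E$. A bipartite graph $G=(U,V;E)$ with $k=|U|-|V|\ge 0$ is $k$-critical-bipartite if, after deleting any $k$ vertices from $U$, the remaining subgraph has a perfect matching. $\delta(G)$ denotes the minimum degree of $G$. A graph is $t$-connected if it has more than $t$ vertices and remains connected whenever strictly fewer than $t$ vertices are removed; the connectivity $\kappa(G)$ is the maximum $t$ such that $G$ is $t$-connected. *)

theory Defs
  imports "Graph_Theory.Digraph_Component" "HOL-Library.Disjoint_Sets"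
begin

text \<open>
  Following the library, a finite simple undirected graph is a symmetric digraph without loops
  and parallel arcs (locale \<^locale>\<open>graph\<close>): the edge \<open>uv\<close> is the pair of arcs from
  \<open>u\<close> to \<open>v\<close> and from \<open>v\<close> to \<open>u\<close>.
\<close>

definition edges :: "('a, 'b) pre_digraph \<Rightarrow> 'a set set" where
  "edges G = {{u, v} | u v. u \<rightarrow>\<^bsub>G\<^esub> v}"

definition del_verts :: "('a, 'b) pre_digraph \<Rightarrow> 'a set \<Rightarrow> ('a, 'b) pre_digraph" where
  "del_verts G S = G \<restriction> (verts G - S)"

definition bipartite_graph :: "('a, 'b) pre_digraph \<Rightarrow> 'a set \<Rightarrow> 'a set \<Rightarrow> bool" where
  "bipartite_graph G U V \<longleftrightarrow> graph G \<and> verts G = U \<union> V \<and> U \<inter> V = {} \<and>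
     (\<forall>e \<in> edges G. \<exists>u \<in> U. \<exists>v \<in> V. e = {u, v})"

definition perfect_matching :: "('a, 'b) pre_digraph \<Rightarrow> 'a set set \<Rightarrow> bool" where
  "perfect_matching G M \<longleftrightarrow> M \<subseteq> edges G \<and> disjoint M \<and> \<Union> M = verts G"

definition critical_bipartite :: "nat \<Rightarrow> ('a, 'b) pre_digraph \<Rightarrow> 'a set \<Rightarrow> 'a set \<Rightarrow> bool" where
  "critical_bipartite k G U V \<longleftrightarrow> bipartite_graph G U V \<and> card U = card V + k \<and>
     (\<forall>S \<subseteq> U. card S = k \<longrightarrow> (\<exists>M. perfect_matching (del_verts G S) M))"

text \<open>
  In a \<^locale>\<open>graph\<close> there are no parallel arcs and all arcs come in opposite pairs, so the
  out-degree of a vertex is its degree.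
\<close>

definition min_degree :: "('a, 'b) pre_digraph \<Rightarrow> nat" where
  "min_degree G = Min (out_degree G ` verts G)"

definition t_connected :: "nat \<Rightarrow> ('a, 'b) pre_digraph \<Rightarrow> bool" where
  "t_connected t G \<longleftrightarrow> t < card (verts G) \<and>
     (\<forall>S \<subseteq> verts G. card S < t \<longrightarrow> connected (del_verts G S))"

text \<open>
  The set below is bounded by the number of vertices, and contains \<open>0\<close> when the graph is finite
  and nonempty, so that its \<^const>\<open>Max\<close> is meaningful.
\<close>

definition connectivity :: "('a, 'b) pre_digraph \<Rightarrow> nat" where
  "connectivity G = Max {t. t_connected t G}"

lemma finite_t_connected: "finite {t. t_connected t G}"
  by (rule finite_subset[of _ "{..<card (verts G)}"]) (auto simp: t_connected_def)

lemma t_connected_0: "finite (verts G) \<Longrightarrow> verts G \<noteq> {} \<Longrightarrow> t_connected 0 G"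
  by (simp add: t_connected_def card_gt_0_iff)

end

theory Submission
  imports Defs
begin

text \<open>
  In a \<open>k\<close>-critical-bipartite graph every nonempty \<open>X \<subseteq> V\<close> has at least \<open>|X| + k\<close> neighbours,
  by deleting \<open>k\<close> vertices of \<open>U\<close> chosen to meet the neighbourhood of \<open>X\<close> as much as possible.
  Suppose that deleting a set \<open>S\<close> of fewer than \<open>min \<delta> k\<close> vertices leaves nonempty parts \<open>A\<close>
  and \<open>B\<close> without edges between them. Both parts meet \<open>V\<close>, as a vertex of \<open>A \<inter> U\<close> has more
  neighbours than \<open>S\<close> has elements. The neighbours of \<open>A \<inter> V\<close> lie in \<open>(A \<union> S) \<inter> U\<close>, and those of
  \<open>B \<inter> V\<close> in \<open>(B \<union> S) \<inter> U\<close>; adding the two inequalities gives \<open>|S| \<ge> k\<close>, a contradiction.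
\<close>

text \<open>Connectivity is strong connectivity of the symmetric closure, so some \<open>v\<close>
  is unreachable there from some \<open>u\<close>; \<open>A\<close> collects what \<open>u\<close>
  reaches and \<open>B\<close> the rest. An arc of \<open>G\<close> between them, in either
  direction, would extend reachability into \<open>B\<close>. The library counts the empty digraph
  as disconnected, whence the assumption that a vertex survives.\<close>

lemma not_connected_del_vertsE:
  assumes "wf_digraph G" and "\<not> connected (del_verts G S)" and "verts G - S \<noteq> {}"
  obtains A B where "A \<union> B = verts G - S" "A \<inter> B = {}" "A \<noteq> {}" "B \<noteq> {}"
    "\<And>a b. a \<in> A \<Longrightarrow> b \<in> B \<Longrightarrow> \<not> a \<rightarrow>\<^bsub>G\<^esub> b" "\<And>a b. a \<in> A \<Longrightarrow> b \<in> B \<Longrightarrow> \<not> b \<rightarrow>\<^bsub>G\<^esub> a"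
proof -
  interpret wf_digraph G by fact
  define H where "H = mk_symmetric (del_verts G S)"
  have wfH: "wf_digraph (with_proj H)"
  proof -
    have "wf_digraph (del_verts G S)"
      unfolding del_verts_def by (rule wellformed_induce_subgraph)
    then show ?thesis
      unfolding H_def using wf_digraph.wellformed_mk_symmetric wf_digraph_wp_iff by blast
  qed
  then interpret H: wf_digraph "with_proj H" .
  have vH: "verts (with_proj H) = verts G - S"
    by (simp add: H_def del_verts_def)
  obtain u v where uv: "u \<in> verts G - S" "v \<in> verts G - S" "\<not> u \<rightarrow>\<^sup>*\<^bsub>with_proj H\<^esub> v"
    using assms(2,3) vH by (auto simp: connected_def strongly_connected_def H_def[symmetric])
  define A where "A = {w. u \<rightarrow>\<^sup>*\<^bsub>with_proj H\<^esub> w}"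
  define B where "B = verts G - S - A"
  have AW: "A \<subseteq> verts G - S"
    using H.reachable_in_verts(2) vH by (auto simp: A_def)
  have adj: "a \<rightarrow>\<^bsub>with_proj H\<^esub> b"
    if "a \<in> verts G - S" "b \<in> verts G - S" "a \<rightarrow>\<^bsub>G\<^esub> b \<or> b \<rightarrow>\<^bsub>G\<^esub> a" for a b
    using that by (auto simp: H_def parcs_mk_symmetric del_verts_def arcs_ends_conv)
  have sep: "\<not> (a \<rightarrow>\<^bsub>G\<^esub> b \<or> b \<rightarrow>\<^bsub>G\<^esub> a)" if "a \<in> A" "b \<in> B" for a b
  proof
    assume "a \<rightarrow>\<^bsub>G\<^esub> b \<or> b \<rightarrow>\<^bsub>G\<^esub> a"
    then have "a \<rightarrow>\<^bsub>with_proj H\<^esub> b"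
      using adj that AW B_def by blast
    then have "b \<in> A"
      using \<open>a \<in> A\<close> H.reachable_adj_trans unfolding A_def by blast
    then show False
      using \<open>b \<in> B\<close> by (simp add: B_def)
  qed
  show thesis
  proof (rule that)
    show "A \<union> B = verts G - S" "A \<inter> B = {}"
      using AW by (auto simp: B_def)
    have "u \<in> A"
      using uv(1) unfolding A_def vH[symmetric] by blast
    then show "A \<noteq> {}"
      by blast
    show "B \<noteq> {}"
      using uv by (auto simp: A_def B_def)
  qed (use sep in auto)
qed

text \<open>If \<open>N\<close> were too small, some deletion of \<open>k\<close> vertices would
  leave fewer than \<open>card X\<close> of its elements, while a perfect matching of the rest sends
  \<open>X\<close> injectively into them. Any \<open>N\<close> containing the neighbours of
  \<open>X\<close> will do, so no neighbourhood operator is needed.\<close>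

lemma critical_bipartite_card_neighbours:
  assumes crit: "critical_bipartite k G U V"
    and X: "X \<subseteq> V" "X \<noteq> {}" and N: "N \<subseteq> U" "\<And>u x. x \<in> X \<Longrightarrow> x \<rightarrow>\<^bsub>G\<^esub> u \<Longrightarrow> u \<in> N"
  shows "card X + k \<le> card N"
proof (rule ccontr)
  assume less: "\<not> card X + k \<le> card N"
  have G: "graph G" "verts G = U \<union> V" "U \<inter> V = {}" and cardU: "card U = card V + k"
    using crit by (auto simp: critical_bipartite_def bipartite_graph_def)
  interpret graph G by fact
  have fin: "finite U" "finite V"
    using finite_verts unfolding G(2) by auto
  then have finX: "finite X" and finN: "finite N"
    using X(1) N(1) finite_subset by blast+
  then have "0 < card X"
    using X(2) by (simp add: card_gt_0_iff)
  \<comment> \<open>Either \<open>S\<close> fits inside \<open>N\<close> and leaves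
    \<open>card N - k\<close> elements, or \<open>S\<close> swallows \<open>N\<close> and leaves
    none.\<close>
  have "\<exists>S\<subseteq>U. card S = k \<and> card (N - S) < card X"
  proof (cases "k \<le> card N")
    case True
    then obtain S where S: "S \<subseteq> N" "card S = k"
      by (meson obtain_subset_with_card_n)
    moreover have "card (N - S) = card N - k"
      using S finN by (simp add: card_Diff_subset finite_subset)
    ultimately show ?thesis
      using N(1) less True by (intro exI[of _ S]) auto
  next
    case False
    then obtain S where "N \<subseteq> S" "S \<subseteq> U" "card S = k"
      using exists_subset_between[of N k U] N(1) cardU fin(1) by auto
    then show ?thesis
      using \<open>0 < card X\<close> by (intro exI[of _ S]) (auto simp: Diff_eq_empty_iff[THEN iffD2])
  qed
  then obtain S where S: "S \<subseteq> U" "card S = k" "card (N - S) < card X"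
    by blast
  then obtain M where M: "M \<subseteq> edges (del_verts G S)" "disjoint M" "\<Union>M = verts G - S"
    using crit by (auto simp: critical_bipartite_def perfect_matching_def del_verts_def)
  \<comment> \<open>As \<open>S\<close> lies in \<open>U\<close>, all of \<open>X\<close> survives
    the deletion and is matched.\<close>
  have "\<exists>u \<in> N - S. {u, x} \<in> M" if x: "x \<in> X" for x
  proof -
    have "x \<in> \<Union>M"
      using x X(1) S(1) G(2,3) M(3) by auto
    then obtain e where e: "e \<in> M" "x \<in> e"
      by blast
    then obtain a b where ab: "e = {a, b}" "a \<rightarrow>\<^bsub>del_verts G S\<^esub> b"
      using M(1) by (auto simp: edges_def)
    then have "a \<rightarrow>\<^bsub>G\<^esub> b"
      by (auto simp: del_verts_def arcs_ends_conv)
    moreover from this have "b \<rightarrow>\<^bsub>G\<^esub> a"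
      by (rule graph_symmetric)
    moreover have "a \<notin> S" "b \<notin> S"
      using e(1) ab(1) M(3) by auto
    ultimately show ?thesis
      using e ab(1) N(2)[OF x] by (auto simp: insert_commute)
  qed
  then obtain f where f: "\<And>x. x \<in> X \<Longrightarrow> f x \<in> N - S \<and> {f x, x} \<in> M"
    by metis
  have "inj_on f X"
  proof (rule inj_onI)
    fix x y assume xy: "x \<in> X" "y \<in> X" "f x = f y"
    then have "{f x, x} = {f x, y}"
      using f M(2) by (metis disjointD disjoint_iff insertI1)
    then show "x = y"
      by (auto simp: doubleton_eq_iff)
  qed
  then have "card X \<le> card (N - S)"
    using f finN by (intro card_inj_on_le) auto
  then show False
    using S(3) by simp
qed

text \<open>Without parallel arcs, \<open>head G\<close> is injective on the arcs leaving
  \<open>u\<close>, so the out-degree counts distinct neighbours.\<close>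

lemma (in digraph) min_degree_le_card:
  assumes "u \<in> verts G" "finite T" "\<And>v. u \<rightarrow>\<^bsub>G\<^esub> v \<Longrightarrow> v \<in> T"
  shows "min_degree G \<le> card T"
proof -
  have "inj_on (head G) (out_arcs G u)"
    by (rule inj_onI) (auto simp: arc_to_ends_def intro: no_multi_arcs)
  moreover have "head G ` out_arcs G u \<subseteq> T"
    using assms(3) by (auto simp: arcs_ends_conv)
  ultimately have "out_degree G u \<le> card T"
    unfolding out_degree_def using assms(2) by (intro card_inj_on_le)
  moreover have "min_degree G \<le> out_degree G u"
    unfolding min_degree_def using assms(1) by (intro Min_le) auto
  ultimately show ?thesis
    by simp
qed

lemma critical_bipartite_t_connected:
  assumes crit: "critical_bipartite k G U V" and "V \<noteq> {}"
  shows "t_connected (min (min_degree G) k) G"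
proof -
  have G: "graph G" "verts G = U \<union> V" "U \<inter> V = {}" and cardU: "card U = card V + k"
    and E: "\<And>e. e \<in> edges G \<Longrightarrow> \<exists>u \<in> U. \<exists>v \<in> V. e = {u, v}"
    using crit by (auto simp: critical_bipartite_def bipartite_graph_def)
  interpret graph G by fact
  have fin: "finite U" "finite V"
    using finite_verts unfolding G(2) by auto
  have "card V > 0"
    using \<open>V \<noteq> {}\<close> fin by (simp add: card_gt_0_iff)
  then have kn: "k < card (verts G)"
    using cardU G(2,3) fin by (simp add: card_Un_disjoint)
  have adjU: "v \<in> V" if "u \<in> U" "u \<rightarrow>\<^bsub>G\<^esub> v" for u v
    using E[of "{u, v}"] that G(3) by (auto simp: edges_def doubleton_eq_iff)
  have adjV: "u \<in> U" if "v \<in> V" "v \<rightarrow>\<^bsub>G\<^esub> u" for u v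
    using E[of "{v, u}"] that G(3) by (auto simp: edges_def doubleton_eq_iff)
  have "connected (del_verts G S)"
    if S: "S \<subseteq> verts G" "card S < min (min_degree G) k" for S
  proof (rule ccontr)
    assume nc: "\<not> connected (del_verts G S)"
    have finS: "finite S"
      using S(1) finite_verts finite_subset by blast
    have ne: "verts G - S \<noteq> {}"
      using S kn by force
    obtain A B where AB: "A \<union> B = verts G - S" "A \<inter> B = {}" "A \<noteq> {}" "B \<noteq> {}"
      and sep: "\<And>a b. a \<in> A \<Longrightarrow> b \<in> B \<Longrightarrow> \<not> a \<rightarrow>\<^bsub>G\<^esub> b"
        "\<And>a b. a \<in> A \<Longrightarrow> b \<in> B \<Longrightarrow> \<not> b \<rightarrow>\<^bsub>G\<^esub> a"
      by (rule not_connected_del_vertsE[OF wf_digraph_axioms nc ne]) (rule that)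
    \<comment> \<open>Stated for a generic \<open>C\<close>, since both sides of the separation
      satisfy the same closure condition.\<close>
    have part: "card (C \<inter> V) + k \<le> card (C \<inter> U) + card (S \<inter> U)"
      if C: "C \<subseteq> verts G" "C \<noteq> {}" "C \<inter> S = {}"
        and closed: "\<And>c x. c \<in> C \<Longrightarrow> c \<rightarrow>\<^bsub>G\<^esub> x \<Longrightarrow> x \<in> C \<union> S" for C
    proof -
      \<comment> \<open>Otherwise a vertex of \<open>C\<close> lies in \<open>U\<close> and has all
        its neighbours in \<open>S\<close>, which is smaller than the minimum degree.\<close>
      have "C \<inter> V \<noteq> {}"
      proof
        assume CV: "C \<inter> V = {}"
        then obtain c where c: "c \<in> C" "c \<in> U"
          using C(1,2) G(2) by blast
        have "min_degree G \<le> card S"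
        proof (rule min_degree_le_card)
          show "c \<in> verts G"
            using c C(1) by blast
          show "x \<in> S" if "c \<rightarrow>\<^bsub>G\<^esub> x" for x
            using closed[OF c(1) that] adjU[OF c(2) that] CV by blast
        qed (fact finS)
        then show False
          using S(2) by simp
      qed
      then have "card (C \<inter> V) + k \<le> card ((C \<union> S) \<inter> U)"
        using closed adjV by (intro critical_bipartite_card_neighbours[OF crit]) auto
      also have "\<dots> \<le> card (C \<inter> U) + card (S \<inter> U)"
        using card_Un_le[of "C \<inter> U" "S \<inter> U"] by (simp add: Int_Un_distrib2)
      finally show ?thesis .
    qed
    have A: "card (A \<inter> V) + k \<le> card (A \<inter> U) + card (S \<inter> U)"
    proof (rule part)
      show "x \<in> A \<union> S" if "c \<in> A" "c \<rightarrow>\<^bsub>G\<^esub> x" for c x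
        using sep that AB(1) adj_in_verts[OF that(2)] by blast
    qed (use AB in auto)
    have B: "card (B \<inter> V) + k \<le> card (B \<inter> U) + card (S \<inter> U)"
    proof (rule part)
      show "x \<in> B \<union> S" if "c \<in> B" "c \<rightarrow>\<^bsub>G\<^esub> x" for c x
        using sep that AB(1) adj_in_verts[OF that(2)] by blast
    qed (use AB in auto)
    have split: "card W = card (A \<inter> W) + card (B \<inter> W) + card (S \<inter> W)"
      if "W \<subseteq> verts G" for W
    proof -
      have "finite W"
        using that finite_verts finite_subset by blast
      moreover have "(A \<inter> W \<union> B \<inter> W) \<union> S \<inter> W = W" "(A \<inter> W) \<inter> (B \<inter> W) = {}"
        "(A \<inter> W \<union> B \<inter> W) \<inter> (S \<inter> W) = {}"
        using that AB(1,2) by auto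
      ultimately show ?thesis
        using card_Un_disjoint[of "A \<inter> W \<union> B \<inter> W" "S \<inter> W"] card_Un_disjoint[of "A \<inter> W" "B \<inter> W"]
        by simp
    qed
    have "card S = card (S \<inter> U) + card (S \<inter> V)"
    proof -
      have "S \<inter> U \<union> S \<inter> V = S" "(S \<inter> U) \<inter> (S \<inter> V) = {}"
        using S(1) G(2,3) by auto
      then show ?thesis
        using finS card_Un_disjoint[of "S \<inter> U" "S \<inter> V"] by simp
    qed
    \<comment> \<open>Summing \<open>A\<close> and \<open>B\<close> and inserting
      \<open>split\<close> gives \<open>card V - card (S \<inter> V) + 2 * k \<le> card U + card (S
      \<inter> U)\<close>; with \<open>card U = card V + k\<close> this is
      \<open>k \<le> card S\<close>.\<close>
    then show False
      using A B split[of U] split[of V] cardU S(2) G(2) by simp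
  qed
  then show ?thesis
    using kn by (auto simp: t_connected_def)
qed

theorem theorem5p3:
  fixes G :: "('a, 'b) pre_digraph" and U V :: "'a set" and n m k :: nat
  assumes "1 < m" and "m < n"
    and "k = n - m"
    and "critical_bipartite k G U V"
    and "card U = n" and "card V = m"
  shows "connectivity G \<ge> min (min_degree G) k"
proof -
  have "V \<noteq> {}"
    using assms(1,6) by auto
  then show ?thesis
    \<comment> \<open>A maximum over a finite set bounds each member, so membership of
      \<open>min (min_degree G) k\<close> suffices.\<close>
    unfolding connectivity_def
    using assms(4) by (intro Max_ge finite_t_connected) (simp add: critical_bipartite_t_connected)
qed

end
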